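(* Let $(X,d)$ be a separable metric space such that the action $(Iso(X),X)$ is Cauchy-indivisible. If $E$ is a group, then the action $(Iso(X),X)$ is embedded densely in the proper action $(E,X\cup X_l)$. That is: $E$ acts properly on $X\cup X_l\subset\widehat X$ by evaluation; the map $Iso(X)\to E$, $g\mapsto\widehat g$, is an embedding of topological groups with dense image $\widehat{Iso(X)}$ in $E$; the inclusion $X\to X\cup X_l$ has dense image; and these maps are equivariant, so that the diagram with evaluation maps $(Iso(X),X)\to X$ and $(E,X\cup X_l)\to\widehat X$ as horizontal arrows, and $(g,x)\mapsto(\widehat g,x)$ and the inclusion $X\to\widehat X$ as vertical arrows, commutes.
   Context: $Iso(X)$ is the group of surjective isometries of $(X,d)$ with the topology of pointwise convergence; it acts on $X$ by evaluation. For a net $\{z_i\}$ in a space $Z$, "$z_i\to\infty$ in $Z$" means that $\{z_i\}$ has no convergent subnet in $Z$. The action $(Iso(X),X)$ is Cauchy-indivisible if: whenever $\{g_i\}$ is a net in $Iso(X)$ with $g_i\to\infty$ in $Iso(X)$ and $\{g_ix\}$ is a Cauchy net for some $x\in X$, then $\{g_ix\}$ is a Cauchy net for every $x\in X$. $(\widehat X,\widehat d)$ is the completion of $(X,d)$; $\widehat g$ is the extension of $g\in Iso(X)$ to $\widehat X$, and $\widehat{Iso(X)}=\{\widehat g: g\in Iso(X)\}$. $C(\widehat X,\widehat X)$ is the space of continuous selfmaps of $\widehat X$ with the topology of pointwise convergence. $E$ (the Ellis semigroup) is the closure of $\widehat{Iso(X)}$ in $C(\widehat X,\widehat X)$, with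 the topology of pointwise convergence and composition of maps. Put $H=\{h\in C(\widehat X,\widehat X):$ there is a sequence $\{g_n\}\subset Iso(X)$ with $g_n\to\infty$ in $Iso(X)$ and $\widehat{g_n}\to h$ in $C(\widehat X,\widehat X)\}$ and $X_l=\{hx: h\in H,\ x\in X\}$. An action $(G,Y)$ of a topological group $G$ on a space $Y$ is proper if for every $x\in Y$ there are no $y\in Y$ and nets $\{x_i\}$ in $Y$, $\{g_i\}$ in $G$ with $g_i\to\infty$ in $G$, $x_i\to x$ and $g_ix_i\to y$. *)

theory Defs
  imports "HOL-Analysis.Analysis" "HOL-Algebra.Group_Action"
begin

section \<open>Nets\<close>

text \<open>
  A net \<open>(z\<^sub>i)\<close> is given by the family \<open>z\<close> and a proper filter on its index type (for a
  directed index set: the filter generated by the tails); subnets correspond to finer proper filters.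
  HOL cannot quantify over all index types inside a definition. So where a definition quantifies
  over all nets in a set \<open>S\<close>, it quantifies over the proper filters on \<open>S\<close> itself, that is, over
  the images of the tail filters. The lemmas below confirm that this amounts to quantifying
  over nets with arbitrary directed index sets.
\<close>

definition net_to_infinity :: "'z topology \<Rightarrow> ('i \<Rightarrow> 'z) \<Rightarrow> 'i filter \<Rightarrow> bool" where
  "net_to_infinity Z z F \<longleftrightarrow> \<not> (\<exists>F' l. F' \<le> F \<and> F' \<noteq> bot \<and> limitin Z z l F')"

definition directed_set :: "'i set \<Rightarrow> ('i \<Rightarrow> 'i \<Rightarrow> bool) \<Rightarrow> bool" where
  "directed_set I r \<longleftrightarrow> I \<noteq> {} \<and> (\<forall>i\<in>I. r i i) \<and>
     (\<forall>i\<in>I. \<forall>j\<in>I. \<forall>k\<in>I. r i j \<longrightarrow> r j k \<longrightarrow> r i k) \<and>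
     (\<forall>i\<in>I. \<forall>j\<in>I. \<exists>k\<in>I. r i k \<and> r j k)"

definition tails :: "'i set \<Rightarrow> ('i \<Rightarrow> 'i \<Rightarrow> bool) \<Rightarrow> 'i filter" where
  "tails I r = (INF i\<in>I. principal {j\<in>I. r i j})"

definition subnet_index ::
  "'i set \<Rightarrow> ('i \<Rightarrow> 'i \<Rightarrow> bool) \<Rightarrow> 'j set \<Rightarrow> ('j \<Rightarrow> 'j \<Rightarrow> bool) \<Rightarrow> ('j \<Rightarrow> 'i) \<Rightarrow> bool" where
  "subnet_index I r J s \<phi> \<longleftrightarrow> directed_set J s \<and> \<phi> ` J \<subseteq> I \<and>
     (\<forall>i\<in>I. \<exists>j\<in>J. \<forall>k\<in>J. s j k \<longrightarrow> r i (\<phi> k))"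

lemma eventually_tails:
  assumes "directed_set I r"
  shows "eventually P (tails I r) \<longleftrightarrow> (\<exists>i\<in>I. \<forall>j\<in>I. r i j \<longrightarrow> P j)"
proof -
  have "eventually P (tails I r) \<longleftrightarrow> (\<exists>i\<in>I. eventually P (principal {j\<in>I. r i j}))"
    unfolding tails_def
  proof (rule eventually_INF_base)
    show "I \<noteq> {}" using assms by (simp add: directed_set_def)
    fix i j assume "i \<in> I" "j \<in> I"
    then obtain k where k: "k \<in> I" "r i k" "r j k"
      using assms unfolding directed_set_def by blast
    have "{l\<in>I. r k l} \<subseteq> {l\<in>I. r i l} \<inter> {l\<in>I. r j l}"
      using assms \<open>i \<in> I\<close> \<open>j \<in> I\<close> k unfolding directed_set_def by blast
    then show "\<exists>x\<in>I. principal {l\<in>I. r x l} \<le>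
        inf (principal {l\<in>I. r i l}) (principal {l\<in>I. r j l})"
      using k by (auto simp: inf_principal)
  qed
  then show ?thesis by (auto simp: eventually_principal)
qed

lemma tails_neq_bot: "directed_set I r \<Longrightarrow> tails I r \<noteq> bot"
  unfolding trivial_limit_def eventually_tails unfolding directed_set_def by blast

lemma subnet_converges_imp:
  assumes "directed_set I r" "subnet_index I r J s \<phi>" "limitin Z (z \<circ> \<phi>) l (tails J s)"
  shows "\<not> net_to_infinity Z z (tails I r)"
proof -
  have J: "directed_set J s" and \<phi>: "\<phi> ` J \<subseteq> I"
    and cof: "\<And>i. i \<in> I \<Longrightarrow> \<exists>j\<in>J. \<forall>k\<in>J. s j k \<longrightarrow> r i (\<phi> k)"
    using assms(2) by (auto simp: subnet_index_def)
  let ?F = "filtermap \<phi> (tails J s)"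
  have "?F \<le> tails I r"
  proof (rule filter_leI)
    fix P assume "eventually P (tails I r)"
    then obtain i where i: "i \<in> I" "\<And>j. j \<in> I \<Longrightarrow> r i j \<Longrightarrow> P j"
      using eventually_tails[OF assms(1)] by blast
    then show "eventually P ?F"
      using cof[OF i(1)] \<phi> by (auto simp: eventually_filtermap eventually_tails[OF J])
  qed
  moreover have "?F \<noteq> bot"
    using tails_neq_bot[OF J] by (simp add: filtermap_bot_iff)
  moreover have "limitin Z z l ?F"
    using assms(3) by (simp add: limitin_def eventually_filtermap)
  ultimately show ?thesis unfolding net_to_infinity_def by blast
qed

theorem net_to_infinity_iff_no_convergent_subnet:
  fixes z :: "'i \<Rightarrow> 'z"
  assumes I: "directed_set I r"
  shows "net_to_infinity Z z (tails I r) \<longleftrightarrow>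
    \<not> (\<exists>(J :: ('i \<times> 'z set) set) s \<phi> l.
          subnet_index I r J s \<phi> \<and> limitin Z (z \<circ> \<phi>) l (tails J s))"
proof
  assume inf: "net_to_infinity Z z (tails I r)"
  show "\<not> (\<exists>(J :: ('i \<times> 'z set) set) s \<phi> l.
      subnet_index I r J s \<phi> \<and> limitin Z (z \<circ> \<phi>) l (tails J s))"
  proof clarify
    fix J :: "('i \<times> 'z set) set" and s \<phi> l
    assume "subnet_index I r J s \<phi>" "limitin Z (z \<circ> \<phi>) l (tails J s)"
    from subnet_converges_imp[OF I this] inf show False by (rule notE)
  qed
next
  assume no: "\<not> (\<exists>(J :: ('i \<times> 'z set) set) s \<phi> l.
      subnet_index I r J s \<phi> \<and> limitin Z (z \<circ> \<phi>) l (tails J s))"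
  show "net_to_infinity Z z (tails I r)"
    unfolding net_to_infinity_def
  proof clarify
    fix F l assume F: "F \<le> tails I r" "F \<noteq> bot" "limitin Z z l F"
    define J where "J = {(i, U). i \<in> I \<and> openin Z U \<and> l \<in> U \<and> z i \<in> U}"
    define s where "s = (\<lambda>(i, U) (j, V). r i j \<and> V \<subseteq> (U :: 'z set))"
    have ex: "\<exists>k. (k, U) \<in> J \<and> r i k \<and> r j k"
      if ij: "i \<in> I" "j \<in> I" and U: "openin Z U" "l \<in> U" for i j U
    proof -
      obtain m where m: "m \<in> I" "r i m" "r j m"
        using I ij unfolding directed_set_def by blast
      have "eventually (\<lambda>k. k \<in> I \<and> r i k \<and> r j k) (tails I r)"
        unfolding eventually_tails[OF I] using I ij m unfolding directed_set_def by blast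
      then have "eventually (\<lambda>k. k \<in> I \<and> r i k \<and> r j k) F"
        by (rule filter_leD[OF F(1)])
      moreover have "eventually (\<lambda>k. z k \<in> U) F"
        using F(3) U by (simp add: limitin_def)
      ultimately have "eventually (\<lambda>k. (k \<in> I \<and> r i k \<and> r j k) \<and> z k \<in> U) F"
        by (rule eventually_conj)
      then obtain k where "(k \<in> I \<and> r i k \<and> r j k) \<and> z k \<in> U"
        using eventually_happens'[OF F(2)] by blast
      then show ?thesis using U by (auto simp: J_def)
    qed
    have trans: "r i k" if "i \<in> I" "j \<in> I" "k \<in> I" "r i j" "r j k" for i j k
      using I that unfolding directed_set_def by blast
    have refl: "r i i" if "i \<in> I" for i
      using I that unfolding directed_set_def by blast
    have l: "l \<in> topspace Z" using F(3) by (simp add: limitin_def)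
    have J: "directed_set J s"
      unfolding directed_set_def
    proof (intro conjI ballI impI)
      show "J \<noteq> {}"
      proof -
        obtain i where "i \<in> I" using I unfolding directed_set_def by blast
        then show ?thesis using ex[OF _ _ openin_topspace l] by blast
      qed
      show "s p p" if "p \<in> J" for p
        using that refl by (auto simp: J_def s_def)
      show "s p t" if "p \<in> J" "q \<in> J" "t \<in> J" "s p q" "s q t" for p q t
      proof -
        obtain i U j V k W where "p = (i, U)" "q = (j, V)" "t = (k, W)"
          by (cases p, cases q, cases t)
        then show ?thesis
          using that trans[of i j k] by (auto simp: J_def s_def)
      qed
      show "\<exists>t\<in>J. s p t \<and> s q t" if "p \<in> J" "q \<in> J" for p q
      proof -
        obtain i U j V where pq: "p = (i, U)" "q = (j, V)"
          by (cases p, cases q)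
        have "i \<in> I" "j \<in> I" "openin Z (U \<inter> V)" "l \<in> U \<inter> V"
          using that pq by (auto simp: J_def)
        from ex[OF this] obtain k where "(k, U \<inter> V) \<in> J" "r i k" "r j k"
          by blast
        then show ?thesis using pq by (intro bexI[of _ "(k, U \<inter> V)"]) (auto simp: s_def)
      qed
    qed
    have "subnet_index I r J s fst"
      unfolding subnet_index_def
    proof (intro conjI ballI J)
      show "fst ` J \<subseteq> I" by (auto simp: J_def)
      fix i assume i: "i \<in> I"
      obtain k where k: "(k, topspace Z) \<in> J" "r i k"
        using ex[OF i i openin_topspace l] by blast
      then show "\<exists>j\<in>J. \<forall>k\<in>J. s j k \<longrightarrow> r i (fst k)"
        using i trans[of i k] by (intro bexI[of _ "(k, topspace Z)"]) (auto simp: J_def s_def)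
    qed
    moreover have "limitin Z (z \<circ> fst) l (tails J s)"
      unfolding limitin_def
    proof (intro conjI allI impI l)
      fix U assume U: "openin Z U \<and> l \<in> U"
      obtain i where i: "i \<in> I" using I unfolding directed_set_def by blast
      then obtain k where "(k, U) \<in> J" using ex[OF i i] U by blast
      then show "eventually (\<lambda>p. (z \<circ> fst) p \<in> U) (tails J s)"
        unfolding eventually_tails[OF J]
        by (intro bexI[of _ "(k, U)"]) (auto simp: J_def s_def)
    qed
    ultimately show False using no by blast
  qed
qed

theorem filter_from_net:
  fixes F :: "'z filter"
  assumes "F \<noteq> bot"
  shows "\<exists>(I :: ('z set \<times> 'z) set) r z. directed_set I r \<and> filtermap z (tails I r) = F"
proof -
  define I where "I = {(A, a). eventually (\<lambda>x. x \<in> A) F \<and> a \<in> A}"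
  define r where "r = (\<lambda>(A :: 'z set, a :: 'z) (B :: 'z set, b :: 'z). B \<subseteq> A)"
  have ne: "\<exists>a. (A, a) \<in> I" if "eventually (\<lambda>x. x \<in> A) F" for A
    using eventually_happens'[OF assms that] that unfolding I_def by blast
  have I: "directed_set I r"
    unfolding directed_set_def
  proof (intro conjI ballI impI)
    show "I \<noteq> {}" using ne[of UNIV] by auto
    show "\<exists>t\<in>I. r p t \<and> r q t" if pq: "p \<in> I" "q \<in> I" for p q
    proof -
      obtain A a B b where *: "p = (A, a)" "q = (B, b)" by (cases p, cases q)
      then obtain c where "(A \<inter> B, c) \<in> I"
        using ne[of "A \<inter> B"] pq by (auto simp: I_def eventually_conj_iff)
      then show ?thesis by (intro bexI[of _ "(A \<inter> B, c)"]) (auto simp: r_def *)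
    qed
  qed (auto simp: r_def)
  have "filtermap snd (tails I r) = F"
    unfolding filter_eq_iff
  proof
    fix P
    show "eventually P (filtermap snd (tails I r)) \<longleftrightarrow> eventually P F"
    proof
      assume "eventually P (filtermap snd (tails I r))"
      then obtain p where p: "p \<in> I" "\<And>q. q \<in> I \<Longrightarrow> r p q \<Longrightarrow> P (snd q)"
        unfolding eventually_filtermap eventually_tails[OF I] by blast
      obtain A a where pa: "p = (A, a)" by (cases p)
      have "eventually (\<lambda>x. x \<in> A) F" "\<And>b. b \<in> A \<Longrightarrow> P b"
        using p(1) p(2)[of "(A, b)" for b] pa by (auto simp: I_def r_def)
      then show "eventually P F" by (auto elim: eventually_mono)
    next
      assume P: "eventually P F"
      then obtain a where "(Collect P, a) \<in> I" using ne[of "Collect P"] by auto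
      then show "eventually P (filtermap snd (tails I r))"
        unfolding eventually_filtermap eventually_tails[OF I]
        by (intro bexI[of _ "(Collect P, a)"]) (auto simp: r_def I_def)
    qed
  qed
  then show ?thesis using I by blast
qed

lemma net_to_infinity_filtermap:
  "net_to_infinity Z (\<lambda>x. x) (filtermap z F) \<longleftrightarrow> net_to_infinity Z z F"
proof
  assume L: "net_to_infinity Z (\<lambda>x. x) (filtermap z F)"
  show "net_to_infinity Z z F"
    unfolding net_to_infinity_def
  proof clarify
    fix F' l assume "F' \<le> F" "F' \<noteq> bot" "limitin Z z l F'"
    then have "filtermap z F' \<le> filtermap z F" "filtermap z F' \<noteq> bot"
      "limitin Z (\<lambda>x. x) l (filtermap z F')"
      by (auto simp: filtermap_mono filtermap_bot_iff limitin_def eventually_filtermap)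
    then show False using L unfolding net_to_infinity_def by blast
  qed
next
  assume R: "net_to_infinity Z z F"
  show "net_to_infinity Z (\<lambda>x. x) (filtermap z F)"
    unfolding net_to_infinity_def
  proof clarify
    fix G l assume G: "G \<le> filtermap z F" "G \<noteq> bot" "limitin Z (\<lambda>x. x) l G"
    define F' where "F' = inf F (filtercomap z G)"
    have "F' \<noteq> bot"
    proof
      assume "F' = bot"
      then have "eventually (\<lambda>_. False) (inf F (filtercomap z G))"
        by (simp add: F'_def)
      then obtain P Q where P: "eventually P F" and Q: "eventually Q (filtercomap z G)"
        and PQ: "\<And>i. P i \<Longrightarrow> Q i \<Longrightarrow> False"
        by (auto simp: eventually_inf)
      obtain R where R: "eventually R G" "\<And>i. R (z i) \<Longrightarrow> Q i"
        using Q by (auto simp: eventually_filtercomap)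
      have "eventually (\<lambda>x. \<not> R x) (filtermap z F)"
        unfolding eventually_filtermap using P by (rule eventually_mono) (use PQ R(2) in blast)
      then have "eventually (\<lambda>x. \<not> R x) G" by (rule filter_leD[OF G(1)])
      with R(1) have "eventually (\<lambda>_. False) G" by eventually_elim blast
      then show False using G(2) by (simp add: trivial_limit_def)
    qed
    moreover have "F' \<le> F" by (simp add: F'_def)
    moreover have "limitin Z z l F'"
      unfolding limitin_def
    proof (intro conjI allI impI)
      show "l \<in> topspace Z" using G(3) by (simp add: limitin_def)
      fix U assume "openin Z U \<and> l \<in> U"
      then have "eventually (\<lambda>x. x \<in> U) G" using G(3) by (simp add: limitin_def)
      then have "eventually (\<lambda>i. z i \<in> U) (filtercomap z G)"
        by (rule eventually_filtercomapI)
      then show "eventually (\<lambda>i. z i \<in> U) F'"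
        unfolding F'_def by (rule filter_leD[rotated]) simp
    qed
    ultimately show False using R unfolding net_to_infinity_def by blast
  qed
qed

section \<open>Topological groups, Cauchy-indivisible and proper actions\<close>

definition topological_group :: "('g, 'm) monoid_scheme \<Rightarrow> 'g topology \<Rightarrow> bool" where
  "topological_group G T \<longleftrightarrow> group G \<and> topspace T = carrier G \<and>
     continuous_map (prod_topology T T) T (\<lambda>(a, b). a \<otimes>\<^bsub>G\<^esub> b) \<and>
     continuous_map T T (\<lambda>a. inv\<^bsub>G\<^esub> a)"

definition continuous_action ::
  "('g, 'm) monoid_scheme \<Rightarrow> 'g topology \<Rightarrow> 'y topology \<Rightarrow> ('g \<Rightarrow> 'y \<Rightarrow> 'y) \<Rightarrow> bool" where
  "continuous_action G T Y \<phi> \<longleftrightarrow> topological_group G T \<and> group_action G (topspace Y) \<phi> \<and>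
     continuous_map (prod_topology T Y) Y (\<lambda>(g, y). \<phi> g y)"

definition proper_action ::
  "('g, 'm) monoid_scheme \<Rightarrow> 'g topology \<Rightarrow> 'y topology \<Rightarrow> ('g \<Rightarrow> 'y \<Rightarrow> 'y) \<Rightarrow> bool" where
  "proper_action G T Y \<phi> \<longleftrightarrow> continuous_action G T Y \<phi> \<and>
     (\<forall>x \<in> topspace Y. \<not> (\<exists>y \<in> topspace Y. \<exists>F :: ('g \<times> 'y) filter.
        F \<noteq> bot \<and> eventually (\<lambda>(g, z). g \<in> carrier G \<and> z \<in> topspace Y) F \<and>
        net_to_infinity T fst F \<and>
        limitin Y snd x F \<and> limitin Y (\<lambda>(g, z). \<phi> g z) y F))"

definition Cauchy_indivisible ::
  "('g, 'm) monoid_scheme \<Rightarrow> 'g topology \<Rightarrow> ('g \<Rightarrow> 'x::metric_space \<Rightarrow> 'x) \<Rightarrow> bool" where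
  "Cauchy_indivisible G T \<phi> \<longleftrightarrow>
     (\<forall>F :: 'g filter. F \<noteq> bot \<and> eventually (\<lambda>g. g \<in> carrier G) F \<and>
        net_to_infinity T (\<lambda>g. g) F \<and> (\<exists>x. cauchy_filter (filtermap (\<lambda>g. \<phi> g x) F)) \<longrightarrow>
        (\<forall>x. cauchy_filter (filtermap (\<lambda>g. \<phi> g x) F)))"

lemma Cauchy_indivisible_netD:
  fixes g :: "'i \<Rightarrow> 'g"
  assumes "Cauchy_indivisible G T \<phi>" "F \<noteq> bot" "eventually (\<lambda>i. g i \<in> carrier G) F"
    "net_to_infinity T g F" "cauchy_filter (filtermap (\<lambda>i. \<phi> (g i) x) F)"
  shows "cauchy_filter (filtermap (\<lambda>i. \<phi> (g i) y) F)"
  using assms(1)[unfolded Cauchy_indivisible_def, rule_format, of "filtermap g F" y] assms(2-)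
  by (auto simp: filtermap_bot_iff eventually_filtermap net_to_infinity_filtermap
      filtermap_filtermap)

lemma proper_action_netD:
  fixes g :: "'i \<Rightarrow> 'g" and z :: "'i \<Rightarrow> 'y"
  assumes "proper_action G T Y \<phi>" "F \<noteq> bot"
    "eventually (\<lambda>i. g i \<in> carrier G \<and> z i \<in> topspace Y) F"
    "limitin Y z x F" "limitin Y (\<lambda>i. \<phi> (g i) (z i)) y F"
  shows "\<not> net_to_infinity T g F"
proof
  assume inf: "net_to_infinity T g F"
  let ?F = "filtermap (\<lambda>i. (g i, z i)) F"
  have "net_to_infinity T fst ?F"
    using inf net_to_infinity_filtermap[of T fst ?F] net_to_infinity_filtermap[of T g F]
    by (simp add: filtermap_filtermap)
  moreover have "limitin Y snd x ?F" "limitin Y (\<lambda>(g, z). \<phi> g z) y ?F"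
    "x \<in> topspace Y" "y \<in> topspace Y"
    using assms by (auto simp: limitin_def eventually_filtermap)
  moreover have "?F \<noteq> bot" "eventually (\<lambda>(g, z). g \<in> carrier G \<and> z \<in> topspace Y) ?F"
    using assms by (auto simp: filtermap_bot_iff eventually_filtermap)
  ultimately show False
    using assms(1) unfolding proper_action_def by blast
qed

section \<open>The isometry group and the Ellis semigroup\<close>

text \<open>The library topology on a function type is the product topology, that is, the topology of
  pointwise convergence.\<close>

definition pointwise :: "('a \<Rightarrow> 'a::topological_space) set \<Rightarrow> ('a \<Rightarrow> 'a) topology" where
  "pointwise S = subtopology euclidean S"

definition composition_monoid :: "('a \<Rightarrow> 'a) set \<Rightarrow> ('a \<Rightarrow> 'a) monoid" where
  "composition_monoid S = \<lparr>carrier = S, mult = (\<circ>), one = id\<rparr>"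

definition Iso :: "('a::metric_space \<Rightarrow> 'a) set" where
  "Iso = {g. surj g \<and> (\<forall>x y. dist (g x) (g y) = dist x y)}"

text \<open>The completion is given up to isometry: a complete space together with an isometric map
  of \<open>X\<close> onto a dense subset.\<close>

definition is_completion :: "('a::metric_space \<Rightarrow> 'b::complete_space) \<Rightarrow> bool" where
  "is_completion \<iota> \<longleftrightarrow> (\<forall>x y. dist (\<iota> x) (\<iota> y) = dist x y) \<and> closure (range \<iota>) = UNIV"

definition extension :: "('a::metric_space \<Rightarrow> 'b::complete_space) \<Rightarrow> ('a \<Rightarrow> 'a) \<Rightarrow> ('b \<Rightarrow> 'b)" where
  "extension \<iota> g = (THE f. continuous_on UNIV f \<and> (\<forall>x. f (\<iota> x) = \<iota> (g x)))"

lemma extension_unique_exists: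
  assumes \<iota>: "is_completion \<iota>" and g: "g \<in> Iso"
  shows "\<exists>!f. continuous_on UNIV f \<and> (\<forall>x. f (\<iota> x) = \<iota> (g x))"
proof -
  have iso: "dist (\<iota> x) (\<iota> y) = dist x y" for x y
    using \<iota> by (simp add: is_completion_def)
  have inj: "inj \<iota>" by (rule injI) (metis iso dist_eq_0_iff)
  have cl: "closure (range \<iota>) = UNIV" using \<iota> by (simp add: is_completion_def)
  let ?k = "\<lambda>y. \<iota> (g (inv_into UNIV \<iota> y))"
  have k: "?k (\<iota> x) = \<iota> (g x)" for x by (simp add: inj)
  have "uniformly_continuous_on (range \<iota>) ?k"
    unfolding uniformly_continuous_on_def
  proof (intro allI impI)
    fix e :: real assume "e > 0"
    then show "\<exists>d>0. \<forall>x\<in>range \<iota>. \<forall>x'\<in>range \<iota>. dist x' x < d \<longrightarrow> dist (?k x') (?k x) < e"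
      using g by (intro exI[of _ e]) (auto simp: inj iso Iso_def)
  qed
  then obtain f where f: "uniformly_continuous_on (closure (range \<iota>)) f"
      "\<And>y. y \<in> range \<iota> \<Longrightarrow> ?k y = f y"
    and uniq: "\<And>Y h x. range \<iota> \<subseteq> Y \<Longrightarrow> Y \<subseteq> closure (range \<iota>) \<Longrightarrow> continuous_on Y h \<Longrightarrow>
      (\<And>x. x \<in> range \<iota> \<Longrightarrow> ?k x = h x) \<Longrightarrow> x \<in> Y \<Longrightarrow> h x = f x"
    by (rule uniformly_continuous_on_extension_on_closure) blast
  show ?thesis
  proof (rule ex1I[of _ f])
    show "continuous_on UNIV f \<and> (\<forall>x. f (\<iota> x) = \<iota> (g x))"
      using f k cl uniformly_continuous_imp_continuous by (metis rangeI)
    show "h = f" if h: "continuous_on UNIV h \<and> (\<forall>x. h (\<iota> x) = \<iota> (g x))" for h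
    proof
      fix y
      have "?k x = h x" if "x \<in> range \<iota>" for x
        using that h k by auto
      then show "h y = f y"
        using uniq[of UNIV h y] h cl by simp
    qed
  qed
qed

definition continuous_selfmaps :: "('b \<Rightarrow> 'b::topological_space) set" where
  "continuous_selfmaps = {f. continuous_on UNIV f}"

definition Ellis :: "('a::metric_space \<Rightarrow> 'b::complete_space) \<Rightarrow> ('b \<Rightarrow> 'b) set" where
  "Ellis \<iota> = pointwise continuous_selfmaps closure_of (extension \<iota> ` Iso)"

definition limit_maps :: "('a::metric_space \<Rightarrow> 'b::complete_space) \<Rightarrow> ('b \<Rightarrow> 'b) set" where
  "limit_maps \<iota> = {h \<in> continuous_selfmaps. \<exists>g :: nat \<Rightarrow> 'a \<Rightarrow> 'a. range g \<subseteq> Iso \<and>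
     net_to_infinity (pointwise Iso) g sequentially \<and>
     limitin (pointwise continuous_selfmaps) (\<lambda>n. extension \<iota> (g n)) h sequentially}"

definition limit_points :: "('a::metric_space \<Rightarrow> 'b::complete_space) \<Rightarrow> 'b set" where
  "limit_points \<iota> = {h (\<iota> x) |h x. h \<in> limit_maps \<iota>}"

text \<open>Evaluation is restricted to \<open>Y\<close> because the values of a library group action are extensional
  bijections of \<open>Y\<close>.\<close>

definition evaluation :: "'y set \<Rightarrow> ('y \<Rightarrow> 'y) \<Rightarrow> 'y \<Rightarrow> 'y" where
  "evaluation Y g = restrict g Y"

end

(*
  Every element of E is an isometry of the completion, and by separability it is the pointwise limit
  of a sequence of extended isometries. Hence E is the union of the extended isometries and H, so
  X \<union> X_l is the orbit E X. For properness, let g_i z_i converge with z_i tending to h x, where h is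
  in E and x in X. Then g_i (h x) converges as well, so by Cauchy-indivisibility (g_i h) has a subnet
  converging in E to some l, and the corresponding subnet of (g_i) converges to l h^(-1), which lies
  in E because E is a group.
*)

theory Submission
  imports Defs
begin

text \<open>Cauchy-indivisibility speaks of nets in \<open>Iso\<close> at points of X, whereas
  properness concerns nets of limit maps at points that may lie outside X. Two transfers bridge the
  gap. The base point is pulled into X by writing it as h x and absorbing h into the net; this is
  possible because X_l contains only images of points of X. The maps in E are replaced by isometries
  of X that approximate them ever better and so have the same limits. Whether or not these tend to
  infinity in \<open>Iso\<close>, a convergent subnet results: failing to tend to infinity means by
  definition that one exists. All limits are controlled by equicontinuity of distance-preserving
  maps: convergence on a dense set spreads to the completion, and pointwise convergence suffices for
  joint continuity of composition and evaluation. A limit of the g_i h determines a limit of the g_i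
  only on the image of h. The inverse of h in the group E makes this image the whole completion and
  keeps the new limit in E.\<close>

definition isometric_maps :: "('a::metric_space \<Rightarrow> 'a) set" where
  "isometric_maps = {f. \<forall>x y. dist (f x) (f y) = dist x y}"

lemma isometric_mapsD: "f \<in> isometric_maps \<Longrightarrow> dist (f x) (f y) = dist x y"
  by (simp add: isometric_maps_def)

lemma continuous_on_isometric_maps:
  assumes "f \<in> isometric_maps"
  shows "continuous_on A f"
  unfolding continuous_on_iff using isometric_mapsD[OF assms] by auto

lemma Iso_subset_isometric_maps: "Iso \<subseteq> isometric_maps"
  by (auto simp: Iso_def isometric_maps_def)

section \<open>Pointwise convergence\<close>

lemma limitin_pointwise:
  "limitin (pointwise S) f l F \<longleftrightarrow>
    l \<in> S \<and> eventually (\<lambda>i. f i \<in> S) F \<and> (\<forall>x. ((\<lambda>i. f i x) \<longlongrightarrow> l x) F)"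
  unfolding pointwise_def limitin_subtopology
  by (simp add: limitin_componentwise flip: euclidean_product_topology)

lemma topspace_pointwise [simp]: "topspace (pointwise S) = S"
  by (simp add: pointwise_def)

text \<open>Testing continuity along filters reduces it, on spaces of maps, to pointwise limits
  through \<open>limitin_pointwise\<close>. Only the filter \<open>atin X x\<close> is actually
  tested.\<close>

lemma continuous_mapI_limitin:
  assumes "\<And>x F. limitin X (\<lambda>a. a) x F \<Longrightarrow> eventually (\<lambda>a. a \<in> topspace X) F \<Longrightarrow>
    limitin Y f (f x) F"
  shows "continuous_map X Y f"
  unfolding continuous_map_atin
proof
  fix x assume x: "x \<in> topspace X"
  have "limitin X (\<lambda>a. a) x (atin X x)"
    using x by (auto simp: limitin_atin)
  moreover have "eventually (\<lambda>a. a \<in> topspace X) (atin X x)"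
    using x by (auto simp: eventually_atin intro: exI[of _ "topspace X"])
  ultimately show "limitin Y f (f x) (atin X x)"
    by (rule assms)
qed

text \<open>A filter on the image converging to f x is pushed forward by the inverse; along the new
  filter f converges to f x, so the second premise yields continuity of the inverse.\<close>

lemma embedding_mapI_limitin:
  assumes "continuous_map X Y f"
    and "\<And>x F. x \<in> topspace X \<Longrightarrow> eventually (\<lambda>a. a \<in> topspace X) F \<Longrightarrow>
      limitin Y f (f x) F \<Longrightarrow> limitin X (\<lambda>a. a) x F"
    and inj: "inj_on f (topspace X)"
  shows "embedding_map X Y f"
proof -
  let ?g = "inv_into (topspace X) f" and ?Z = "subtopology Y (f ` topspace X)"
  have fY: "f ` topspace X \<subseteq> topspace Y"
    using assms(1) by (simp add: continuous_map_image_subset_topspace)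
  have "continuous_map ?Z X ?g"
  proof (rule continuous_mapI_limitin)
    fix y F assume lim: "limitin ?Z (\<lambda>a. a) y F"
      and ev: "eventually (\<lambda>a. a \<in> topspace ?Z) F"
    have y: "y \<in> f ` topspace X" using lim by (simp add: limitin_subtopology)
    have ev': "eventually (\<lambda>a. a \<in> f ` topspace X) F"
      using ev by (rule eventually_mono) simp
    have "limitin Y (\<lambda>a. f (?g a)) (f (?g y)) F"
    proof (rule limitin_transform_eventually)
      show "eventually (\<lambda>a. a = f (?g a)) F"
        using ev' by (rule eventually_mono) (simp add: f_inv_into_f)
      show "limitin Y (\<lambda>a. a) (f (?g y)) F"
        using lim y by (simp add: limitin_subtopology f_inv_into_f)
    qed
    then have "limitin Y f (f (?g y)) (filtermap ?g F)"
      by (simp add: limitin_def eventually_filtermap)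
    moreover have "eventually (\<lambda>a. a \<in> topspace X) (filtermap ?g F)"
      unfolding eventually_filtermap using ev' by (rule eventually_mono) (rule inv_into_into)
    ultimately have "limitin X (\<lambda>a. a) (?g y) (filtermap ?g F)"
      using y by (intro assms(2)) (auto intro: inv_into_into)
    then show "limitin X ?g (?g y) F"
      by (simp add: limitin_def eventually_filtermap)
  qed
  moreover have "continuous_map X ?Z f"
    using assms(1) by (simp add: continuous_map_in_subtopology)
  ultimately have "homeomorphic_maps X ?Z f ?g"
    using fY by (auto simp: homeomorphic_maps_def inj f_inv_into_f)
  then show ?thesis
    unfolding embedding_map_def homeomorphic_map_maps by blast
qed

section \<open>Limits of nets of distance-preserving maps\<close>

lemma tendsto_if_dist_le_add:
  assumes "(a \<longlongrightarrow> 0) F" "(b \<longlongrightarrow> (0::real)) F"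
    and "eventually (\<lambda>i. dist (f i) l \<le> a i + b i) F"
  shows "(f \<longlongrightarrow> l) F"
proof -
  have "((\<lambda>i. a i + b i) \<longlongrightarrow> 0) F"
    using tendsto_add[OF assms(1,2)] by simp
  then show ?thesis
    by (rule metric_tendsto_imp_tendsto) (use assms(3) in eventually_elim, simp)
qed

lemma tendsto_transform_dist:
  assumes "(f \<longlongrightarrow> l) F" "((\<lambda>i. dist (f i) (h i)) \<longlongrightarrow> 0) F"
  shows "(h \<longlongrightarrow> l) F"
proof (rule tendsto_if_dist_le_add[OF assms(2)])
  show "((\<lambda>i. dist (f i) l) \<longlongrightarrow> 0) F" using assms(1) by (rule iffD1[OF tendsto_dist_iff])
  show "eventually (\<lambda>i. dist (h i) l \<le> dist (f i) (h i) + dist (f i) l) F"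
    by (intro always_eventually allI) (rule dist_triangle3)
qed

text \<open>Pointwise convergence does not in general allow a moving argument. Here all maps are
  1-Lipschitz, so moving from z_i to y costs only dist (z_i) y.\<close>

lemma tendsto_isometric_compose:
  assumes f: "eventually (\<lambda>i. f i \<in> isometric_maps) F"
    and "((\<lambda>i. f i y) \<longlongrightarrow> l) F" "(z \<longlongrightarrow> y) F"
  shows "((\<lambda>i. f i (z i)) \<longlongrightarrow> l) F"
proof (rule tendsto_if_dist_le_add)
  show "((\<lambda>i. dist (z i) y) \<longlongrightarrow> 0) F" "((\<lambda>i. dist (f i y) l) \<longlongrightarrow> 0) F"
    using assms(2,3) by (simp_all add: tendsto_dist_iff[symmetric])
  show "eventually (\<lambda>i. dist (f i (z i)) l \<le> dist (z i) y + dist (f i y) l) F"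
    using f
  proof eventually_elim
    case (elim i)
    then show ?case
      using dist_triangle[of "f i (z i)" l "f i y"] isometric_mapsD[of "f i" "z i" y] by simp
  qed
qed

text \<open>An e/3 argument: passing from y to a nearby point of D costs the same for every i. The
  comparison map \<open>h i\<close> may itself vary, because \<open>Ellis_approximants\<close>
  approximates a whole net of maps.\<close>

lemma tendsto_isometric_dense:
  fixes f h :: "'i \<Rightarrow> 'b::metric_space \<Rightarrow> 'b"
  assumes f: "eventually (\<lambda>i. f i \<in> isometric_maps) F"
    and h: "eventually (\<lambda>i. h i \<in> isometric_maps) F"
    and D: "closure D = UNIV"
    and lim: "\<And>x. x \<in> D \<Longrightarrow> ((\<lambda>i. dist (f i x) (h i x)) \<longlongrightarrow> 0) F"
  shows "((\<lambda>i. dist (f i y) (h i y)) \<longlongrightarrow> 0) F"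
  unfolding tendsto_iff
proof (intro allI impI)
  fix e :: real assume "e > 0"
  then obtain x where x: "x \<in> D" "dist x y < e / 3"
    using D closure_approachable[of y D] by (metis UNIV_I divide_pos_pos zero_less_numeral)
  have "eventually (\<lambda>i. dist (dist (f i x) (h i x)) 0 < e / 3) F"
    using tendstoD[OF lim[OF x(1)], of "e / 3"] \<open>e > 0\<close> by simp
  with f h show "eventually (\<lambda>i. dist (dist (f i y) (h i y)) 0 < e) F"
  proof eventually_elim
    case (elim i)
    have "dist (f i x) (h i x) < e / 3" using elim by simp
    moreover have "dist (f i y) (h i y) \<le> dist (f i y) (f i x) + dist (f i x) (h i x) + dist (h i x) (h i y)"
      by metric
    ultimately show ?case
      using elim(1,2) x(2) by (simp add: isometric_mapsD dist_commute)
  qed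
qed

lemma tendsto_isometric_dense_const:
  assumes "eventually (\<lambda>i. f i \<in> isometric_maps) F" "h \<in> isometric_maps" "closure D = UNIV"
    and "\<And>x. x \<in> D \<Longrightarrow> ((\<lambda>i. f i x) \<longlongrightarrow> h x) F"
  shows "((\<lambda>i. f i y) \<longlongrightarrow> h y) F"
  using tendsto_isometric_dense[of f F "\<lambda>_. h" D y] assms
  by (simp add: tendsto_dist_iff[symmetric])

lemma Cauchy_convergent_filter:
  fixes f :: "'i \<Rightarrow> 'b::complete_space"
  assumes "cauchy_filter (filtermap f F)" "F \<noteq> bot"
  shows "\<exists>l. (f \<longlongrightarrow> l) F"
  using cauchy_filter_complete_converges[OF assms(1) complete_UNIV] assms(2)
  by (auto simp: filtermap_bot_iff filterlim_def)

section \<open>Groups of isometries act continuously\<close>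

lemma composition_monoid_simps [simp]:
  "carrier (composition_monoid S) = S"
  "f \<otimes>\<^bsub>composition_monoid S\<^esub> g = f \<circ> g"
  "\<one>\<^bsub>composition_monoid S\<^esub> = id"
  by (simp_all add: composition_monoid_def)

lemma composition_group_inv:
  assumes "group (composition_monoid S)" "f \<in> S"
  shows "inv\<^bsub>composition_monoid S\<^esub> f \<in> S"
    and "(inv\<^bsub>composition_monoid S\<^esub> f) (f x) = x"
    and "f ((inv\<^bsub>composition_monoid S\<^esub> f) x) = x"
  using group.inv_closed[OF assms(1)] group.l_inv[OF assms(1)] group.r_inv[OF assms(1)] assms(2)
  by (auto simp: fun_eq_iff)

lemma topological_group_isometries:
  fixes S :: "('a::metric_space \<Rightarrow> 'a) set"
  assumes G: "group (composition_monoid S)" and S: "S \<subseteq> isometric_maps"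
  shows "topological_group (composition_monoid S) (pointwise S)"
  unfolding topological_group_def
proof (intro conjI G)
  show "continuous_map (prod_topology (pointwise S) (pointwise S)) (pointwise S)
      (\<lambda>(a, b). a \<otimes>\<^bsub>composition_monoid S\<^esub> b)"
  proof (rule continuous_mapI_limitin)
    fix p :: "('a \<Rightarrow> 'a) \<times> ('a \<Rightarrow> 'a)" and F
    assume lim: "limitin (prod_topology (pointwise S) (pointwise S)) (\<lambda>q. q) p F"
    have ev: "eventually (\<lambda>q. fst q \<in> S \<and> snd q \<in> S) F" and p: "fst p \<in> S" "snd p \<in> S"
      and l1: "\<And>x. ((\<lambda>q. fst q x) \<longlongrightarrow> fst p x) F" and l2: "\<And>x. ((\<lambda>q. snd q x) \<longlongrightarrow> snd p x) F"
      using lim by (auto simp: limitin_pairwise limitin_pointwise o_def eventually_conj_iff)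
    have cl: "f \<circ> g \<in> S" if "f \<in> S" "g \<in> S" for f g
      using monoid.m_closed[OF group.is_monoid[OF G]] that by simp
    have iso: "eventually (\<lambda>q. fst q \<in> isometric_maps) F"
      using ev by (rule eventually_mono) (use S in auto)
    have "((\<lambda>q. fst q (snd q x)) \<longlongrightarrow> fst p (snd p x)) F" for x
      by (rule tendsto_isometric_compose[OF iso l1 l2])
    moreover have "eventually (\<lambda>q. fst q \<circ> snd q \<in> S) F"
      using ev by (rule eventually_mono) (simp add: cl)
    ultimately show "limitin (pointwise S) (\<lambda>(a, b). a \<otimes>\<^bsub>composition_monoid S\<^esub> b)
        (case p of (a, b) \<Rightarrow> a \<otimes>\<^bsub>composition_monoid S\<^esub> b) F"
      using p cl by (simp add: limitin_pointwise case_prod_unfold)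
  qed
  let ?i = "\<lambda>a. inv\<^bsub>composition_monoid S\<^esub> a"
  show "continuous_map (pointwise S) (pointwise S) ?i"
  proof (rule continuous_mapI_limitin)
    fix p :: "'a \<Rightarrow> 'a" and F
    assume lim: "limitin (pointwise S) (\<lambda>q. q) p F"
    then have p: "p \<in> S" and ev: "eventually (\<lambda>q. q \<in> S) F"
      and l: "\<And>x. ((\<lambda>q. q x) \<longlongrightarrow> p x) F"
      by (auto simp: limitin_pointwise)
    have "((\<lambda>q. ?i q x) \<longlongrightarrow> ?i p x) F" for x
    proof -
      \<comment> \<open>Applying the isometry q turns the distance between the inverses of q and p
        at x into the distance between x and q at the fixed point \<open>?i p x\<close>, where
        pointwise convergence applies.\<close>
      have "((\<lambda>q. dist (q (?i p x)) x) \<longlongrightarrow> 0) F"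
        using l[of "?i p x"] composition_group_inv(3)[OF G p]
        by (simp add: tendsto_dist_iff[symmetric])
      moreover have "eventually (\<lambda>q. dist (q (?i p x)) x = dist (?i q x) (?i p x)) F"
        using ev
      proof eventually_elim
        case (elim q)
        then have "dist (?i q x) (?i p x) = dist (q (?i q x)) (q (?i p x))"
          using S by (simp add: isometric_mapsD subset_iff)
        then show ?case
          using composition_group_inv(3)[OF G elim] by (simp add: dist_commute)
      qed
      ultimately show ?thesis
        by (subst tendsto_dist_iff) (rule Lim_transform_eventually)
    qed
    moreover have "eventually (\<lambda>q. ?i q \<in> S) F"
      using ev by (rule eventually_mono) (rule composition_group_inv(1)[OF G])
    ultimately show "limitin (pointwise S) ?i (?i p) F"
      using composition_group_inv(1)[OF G p] by (simp add: limitin_pointwise)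
  qed
qed simp

text \<open>The generality in S and Y serves both \<open>Iso\<close> on X and the Ellis semigroup on
  the orbit of X. Bijectivity on Y comes from the group inverse, which lies in S and hence also
  preserves Y.\<close>

lemma continuous_action_isometries:
  fixes S :: "('a::metric_space \<Rightarrow> 'a) set"
  assumes G: "group (composition_monoid S)" and S: "S \<subseteq> isometric_maps"
    and Y: "\<And>f y. f \<in> S \<Longrightarrow> y \<in> Y \<Longrightarrow> f y \<in> Y"
  shows "continuous_action (composition_monoid S) (pointwise S) (top_of_set Y) (evaluation Y)"
  unfolding continuous_action_def
proof (intro conjI topological_group_isometries G S)
  have bij: "evaluation Y f \<in> Bij Y" if f: "f \<in> S" for f
  proof -
    note i = composition_group_inv[OF G f]
    have "bij_betw f Y Y"
      by (rule bij_betw_byWitness[where f' = "inv\<^bsub>composition_monoid S\<^esub> f"])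
        (use i Y f in auto)
    then show ?thesis by (simp add: Bij_def evaluation_def bij_betw_restrict_eq)
  qed
  have "evaluation Y \<in> hom (composition_monoid S) (BijGroup Y)"
    using bij Y by (auto simp: hom_def BijGroup_def compose_def evaluation_def fun_eq_iff)
  then show "group_action (composition_monoid S) (topspace (top_of_set Y)) (evaluation Y)"
    by (auto simp: group_action_def group_hom_def group_hom_axioms_def G group_BijGroup)
  show "continuous_map (prod_topology (pointwise S) (top_of_set Y)) (top_of_set Y)
      (\<lambda>(g, y). evaluation Y g y)"
  proof (rule continuous_mapI_limitin)
    fix p :: "('a \<Rightarrow> 'a) \<times> 'a" and F
    assume lim: "limitin (prod_topology (pointwise S) (top_of_set Y)) (\<lambda>q. q) p F"
    have ev: "eventually (\<lambda>q. fst q \<in> S \<and> snd q \<in> Y) F" and p: "fst p \<in> S" "snd p \<in> Y"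
      and l1: "\<And>x. ((\<lambda>q. fst q x) \<longlongrightarrow> fst p x) F" and l2: "(snd \<longlongrightarrow> snd p) F"
      using lim
      by (auto simp: limitin_pairwise limitin_pointwise limitin_subtopology o_def
          eventually_conj_iff)
    have iso: "eventually (\<lambda>q. fst q \<in> isometric_maps) F"
      using ev by (rule eventually_mono) (use S in auto)
    have "((\<lambda>q. fst q (snd q)) \<longlongrightarrow> fst p (snd p)) F"
      by (rule tendsto_isometric_compose[OF iso l1 l2])
    moreover have eq: "eventually (\<lambda>q. fst q (snd q) = evaluation Y (fst q) (snd q)) F"
      using ev by (rule eventually_mono) (simp add: evaluation_def)
    ultimately have "((\<lambda>q. evaluation Y (fst q) (snd q)) \<longlongrightarrow> fst p (snd p)) F"
      by (rule Lim_transform_eventually)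
    moreover have "eventually (\<lambda>q. evaluation Y (fst q) (snd q) \<in> Y) F"
      using ev by (rule eventually_mono) (simp add: evaluation_def Y)
    ultimately show "limitin (top_of_set Y) (\<lambda>(g, y). evaluation Y g y)
        (case p of (g, y) \<Rightarrow> evaluation Y g y) F"
      using p Y by (simp add: limitin_subtopology case_prod_unfold evaluation_def)
  qed
qed

lemma Iso_comp:
  assumes "f \<in> Iso" "g \<in> Iso"
  shows "f \<circ> g \<in> Iso"
proof -
  have "surj (f \<circ> g)"
    by (rule comp_surj) (use assms in \<open>simp_all add: Iso_def\<close>)
  then show ?thesis using assms by (simp add: Iso_def)
qed

lemma group_Iso: "group (composition_monoid (Iso :: ('a::metric_space \<Rightarrow> 'a) set))"
proof (rule groupI)
  fix f :: "'a \<Rightarrow> 'a"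
  assume "f \<in> carrier (composition_monoid Iso)"
  then have f: "surj f" "\<And>x y. dist (f x) (f y) = dist x y" by (auto simp: Iso_def)
  have inj: "inj f" by (rule injI) (metis f(2) dist_eq_0_iff)
  have "dist (inv_into UNIV f x) (inv_into UNIV f y) = dist x y" for x y
    using f(2)[of "inv_into UNIV f x" "inv_into UNIV f y"] by (simp add: surj_f_inv_f[OF f(1)])
  then have "inv_into UNIV f \<in> Iso" using inj by (simp add: Iso_def inj_imp_surj_inv)
  then show "\<exists>g\<in>carrier (composition_monoid Iso).
      g \<otimes>\<^bsub>composition_monoid Iso\<^esub> f = \<one>\<^bsub>composition_monoid Iso\<^esub>"
    using inj by (intro bexI[of _ "inv_into UNIV f"]) auto
qed (auto intro: Iso_comp simp: o_assoc, simp add: Iso_def)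

section \<open>Extensions to the completion\<close>

lemma is_completionD:
  assumes "is_completion \<iota>"
  shows "dist (\<iota> x) (\<iota> y) = dist x y" "closure (range \<iota>) = UNIV" "inj \<iota>"
proof -
  show *: "dist (\<iota> x) (\<iota> y) = dist x y" for x y
    using assms by (simp add: is_completion_def)
  show "closure (range \<iota>) = UNIV" using assms by (simp add: is_completion_def)
  show "inj \<iota>" by (rule injI) (metis * dist_eq_0_iff)
qed

lemma tendsto_completion_iff:
  assumes "is_completion \<iota>"
  shows "((\<lambda>i. \<iota> (f i)) \<longlongrightarrow> \<iota> l) F \<longleftrightarrow> (f \<longlongrightarrow> l) F"
  unfolding tendsto_dist_iff[of _ "\<iota> l"] tendsto_dist_iff[of f]
  by (simp add: is_completionD[OF assms])

text \<open>The pairs whose distance f preserves form a closed set containing D x D, which is dense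
  in the square.\<close>

lemma isometric_on_dense:
  assumes f: "continuous_on UNIV f" and D: "closure D = UNIV"
    and iso: "\<And>x y. x \<in> D \<Longrightarrow> y \<in> D \<Longrightarrow> dist (f x) (f y) = dist x y"
  shows "f \<in> isometric_maps"
proof -
  have "closure (D \<times> D) \<subseteq> {p. dist (f (fst p)) (f (snd p)) = dist (fst p) (snd p)}"
    by (rule closure_minimal)
      (auto simp: iso intro!: closed_Collect_eq continuous_intros continuous_on_compose2[OF f])
  then have "UNIV \<subseteq> {p. dist (f (fst p)) (f (snd p)) = dist (fst p) (snd p)}"
    by (simp add: D closure_Times)
  from subsetD[OF this UNIV_I, of "(x, y)" for x y] show ?thesis
    by (simp add: isometric_maps_def)
qed

lemma
  assumes "is_completion \<iota>" "g \<in> Iso"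
  shows continuous_on_extension: "continuous_on UNIV (extension \<iota> g)"
    and extension_apply: "extension \<iota> g (\<iota> x) = \<iota> (g x)"
  using theI'[OF extension_unique_exists[OF assms]] by (auto simp: extension_def)

lemma extension_eqI:
  assumes "is_completion \<iota>" "g \<in> Iso" "continuous_on UNIV f" "\<And>x. f (\<iota> x) = \<iota> (g x)"
  shows "extension \<iota> g = f"
  unfolding extension_def using assms by (intro the1_equality extension_unique_exists) auto

lemma extension_isometric:
  assumes "is_completion \<iota>" "g \<in> Iso"
  shows "extension \<iota> g \<in> isometric_maps"
  using continuous_on_extension[OF assms] is_completionD(2)[OF assms(1)]
proof (rule isometric_on_dense)
  fix x y assume "x \<in> range \<iota>" "y \<in> range \<iota>"
  then show "dist (extension \<iota> g x) (extension \<iota> g y) = dist x y"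
    using assms by (auto simp: extension_apply is_completionD Iso_def)
qed

section \<open>The Ellis semigroup as a closed set of isometric maps\<close>

lemma Ellis_iff: "f \<in> Ellis \<iota> \<longleftrightarrow>
    continuous_on UNIV f \<and> f \<in> closure (extension \<iota> ` Iso \<inter> continuous_selfmaps)"
  by (auto simp: Ellis_def pointwise_def closure_of_subtopology continuous_selfmaps_def Int_commute)

lemma extension_in_Ellis:
  assumes "is_completion \<iota>" "g \<in> Iso"
  shows "extension \<iota> g \<in> Ellis \<iota>"
  using assms continuous_on_extension[OF assms]
  by (auto simp: Ellis_iff continuous_selfmaps_def intro!: subsetD[OF closure_subset])

text \<open>Preserving distances is a closed condition for pointwise convergence. Surjectivity need
  not survive pointwise limits, so \<open>isometric_maps\<close> does not ask for it.\<close>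

lemma Ellis_isometric:
  assumes "is_completion \<iota>"
  shows "Ellis \<iota> \<subseteq> isometric_maps"
proof -
  have cl: "closed (isometric_maps :: ('b::complete_space \<Rightarrow> 'b) set)"
    unfolding isometric_maps_def
    by (intro closed_Collect_all closed_Collect_eq continuous_intros
        continuous_on_product_coordinates)
  have "closure (extension \<iota> ` Iso \<inter> continuous_selfmaps) \<subseteq> isometric_maps"
    by (rule closure_minimal[OF _ cl]) (use extension_isometric[OF assms] in auto)
  then show ?thesis by (auto simp: Ellis_iff)
qed

text \<open>By definition \<open>Ellis\<close> is closed only relative to the continuous selfmaps,
  and a pointwise limit of continuous maps may be discontinuous. Limits of isometric maps are
  isometric, so here continuity is automatic.\<close>

lemma Ellis_if_limit:
  assumes \<iota>: "is_completion \<iota>" and "F \<noteq> bot" "eventually (\<lambda>i. f i \<in> Ellis \<iota>) F"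
    and lim: "\<And>x. ((\<lambda>i. f i x) \<longlongrightarrow> l x) F"
  shows "l \<in> Ellis \<iota>"
proof -
  let ?C = "closure (extension \<iota> ` Iso \<inter> continuous_selfmaps)"
  have "(f \<longlongrightarrow> l) F"
    using limitin_pointwise[of UNIV f l F] lim by (simp add: pointwise_def)
  moreover have "eventually (\<lambda>i. f i \<in> ?C) F"
    using assms(3) by (rule eventually_mono) (simp add: Ellis_iff)
  ultimately have "l \<in> ?C"
    using Lim_in_closed_set[OF closed_closure _ \<open>F \<noteq> bot\<close>] by blast
  moreover have "continuous_on UNIV l"
  proof (rule continuous_on_isometric_maps)
    have "dist (l x) (l y) = dist x y" for x y
    proof -
      have "eventually (\<lambda>i. dist (f i x) (f i y) = dist x y) F"
        using assms(3)
        by (rule eventually_mono) (use Ellis_isometric[OF \<iota>] in \<open>auto simp: isometric_mapsD\<close>)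
      then have "((\<lambda>i. dist (f i x) (f i y)) \<longlongrightarrow> dist x y) F"
        by (simp add: tendsto_eventually)
      then show ?thesis
        using tendsto_dist[OF lim lim] \<open>F \<noteq> bot\<close> tendsto_unique by blast
    qed
    then show "l \<in> isometric_maps" by (simp add: isometric_maps_def)
  qed
  ultimately show ?thesis by (simp add: Ellis_iff)
qed

section \<open>The isometry group inside the Ellis semigroup, and X inside the completion\<close>

lemma extension_hom:
  assumes \<iota>: "is_completion \<iota>"
  shows "extension \<iota> \<in> hom (composition_monoid Iso) (composition_monoid (Ellis \<iota>))"
proof (rule homI)
  fix f g :: "'a \<Rightarrow> 'a"
  assume "f \<in> carrier (composition_monoid Iso)" "g \<in> carrier (composition_monoid Iso)"
  then have fg: "f \<in> Iso" "g \<in> Iso" by auto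
  then have "f \<circ> g \<in> Iso" by (rule Iso_comp)
  moreover have "continuous_on UNIV (extension \<iota> f \<circ> extension \<iota> g)"
    by (intro continuous_on_compose continuous_on_subset[OF continuous_on_extension])
      (use \<iota> fg in auto)
  \<comment> \<open>Both sides are continuous and agree on the dense image of X, so uniqueness of
    the extension identifies them.\<close>
  ultimately have "extension \<iota> (f \<circ> g) = extension \<iota> f \<circ> extension \<iota> g"
    using \<iota> fg by (intro extension_eqI) (auto simp: extension_apply)
  then show "extension \<iota> (f \<otimes>\<^bsub>composition_monoid Iso\<^esub> g) =
      extension \<iota> f \<otimes>\<^bsub>composition_monoid (Ellis \<iota>)\<^esub> extension \<iota> g"
    by simp
qed (use extension_in_Ellis[OF \<iota>] in auto)

lemma tendsto_extension:
  assumes \<iota>: "is_completion \<iota>" and "g \<in> Iso" "eventually (\<lambda>i. u i \<in> Iso) F"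
    and "\<And>x. ((\<lambda>i. u i x) \<longlongrightarrow> g x) F"
  shows "((\<lambda>i. extension \<iota> (u i) y) \<longlongrightarrow> extension \<iota> g y) F"
proof (rule tendsto_isometric_dense_const[where h = "extension \<iota> g" and
      f = "\<lambda>i. extension \<iota> (u i)", OF _ _ is_completionD(2)[OF \<iota>]])
  show "eventually (\<lambda>i. extension \<iota> (u i) \<in> isometric_maps) F"
    using assms(3) by (rule eventually_mono) (rule extension_isometric[OF \<iota>])
  show "extension \<iota> g \<in> isometric_maps" using assms by (simp add: extension_isometric)
  fix y assume "y \<in> range \<iota>"
  then obtain x where y: "y = \<iota> x" by blast
  have "((\<lambda>i. \<iota> (u i x)) \<longlongrightarrow> \<iota> (g x)) F"
    using assms by (simp add: tendsto_completion_iff[OF \<iota>])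
  moreover have "eventually (\<lambda>i. \<iota> (u i x) = extension \<iota> (u i) y) F"
    using assms(3) by (rule eventually_mono) (simp add: y extension_apply \<iota>)
  ultimately have "((\<lambda>i. extension \<iota> (u i) y) \<longlongrightarrow> \<iota> (g x)) F"
    by (rule Lim_transform_eventually)
  then show "((\<lambda>i. extension \<iota> (u i) y) \<longlongrightarrow> extension \<iota> g y) F"
    using assms by (simp add: y extension_apply)
qed

text \<open>Continuity is convergence spreading from X to the completion. Conversely, at points of
  \<open>range \<iota>\<close> the extension is the original map, so convergence there gives back
  convergence on X.\<close>

lemma extension_embedding:
  assumes \<iota>: "is_completion \<iota>"
  shows "embedding_map (pointwise Iso) (pointwise (Ellis \<iota>)) (extension \<iota>)"
proof (rule embedding_mapI_limitin)
  show "continuous_map (pointwise Iso) (pointwise (Ellis \<iota>)) (extension \<iota>)"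
  proof (rule continuous_mapI_limitin)
    fix g :: "'a \<Rightarrow> 'a" and F
    assume "limitin (pointwise Iso) (\<lambda>a. a) g F"
    then have *: "g \<in> Iso" "eventually (\<lambda>a. a \<in> Iso) F" "\<And>x. ((\<lambda>a. a x) \<longlongrightarrow> g x) F"
      by (auto simp: limitin_pointwise)
    then show "limitin (pointwise (Ellis \<iota>)) (extension \<iota>) (extension \<iota> g) F"
      using tendsto_extension[OF \<iota> *] extension_in_Ellis[OF \<iota>]
      by (auto simp: limitin_pointwise elim: eventually_mono)
  qed
  show "inj_on (extension \<iota>) (topspace (pointwise Iso))"
  proof (rule inj_onI)
    fix f g :: "'a \<Rightarrow> 'a"
    assume "f \<in> topspace (pointwise Iso)" "g \<in> topspace (pointwise Iso)"
      and eq: "extension \<iota> f = extension \<iota> g"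
    then have "\<iota> (f x) = \<iota> (g x)" for x
      using extension_apply[OF \<iota>] by (metis topspace_pointwise)
    then show "f = g" using is_completionD(3)[OF \<iota>] by (auto simp: inj_eq)
  qed
  fix g :: "'a \<Rightarrow> 'a" and F
  assume g: "g \<in> topspace (pointwise Iso)" and ev: "eventually (\<lambda>a. a \<in> topspace (pointwise Iso)) F"
    and "limitin (pointwise (Ellis \<iota>)) (extension \<iota>) (extension \<iota> g) F"
  then have lim: "((\<lambda>a. extension \<iota> a y) \<longlongrightarrow> extension \<iota> g y) F" for y
    by (simp add: limitin_pointwise)
  have "((\<lambda>a. a x) \<longlongrightarrow> g x) F" for x
  proof -
    have "eventually (\<lambda>a. extension \<iota> a (\<iota> x) = \<iota> (a x)) F"
      using ev by (rule eventually_mono) (simp add: extension_apply \<iota>)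
    with lim[of "\<iota> x"] have "((\<lambda>a. \<iota> (a x)) \<longlongrightarrow> extension \<iota> g (\<iota> x)) F"
      by (rule Lim_transform_eventually)
    then show ?thesis
      using g tendsto_completion_iff[OF \<iota>, of "\<lambda>a. a x"] by (simp add: extension_apply \<iota>)
  qed
  then show "limitin (pointwise Iso) (\<lambda>a. a) g F"
    using g ev by (simp add: limitin_pointwise)
qed

lemma completion_embedding:
  assumes \<iota>: "is_completion \<iota>" and "range \<iota> \<subseteq> Y"
  shows "embedding_map euclidean (top_of_set Y) \<iota>"
proof -
  have "embedding_map euclidean euclidean \<iota>"
  proof (rule embedding_mapI_limitin)
    show "continuous_map euclidean euclidean \<iota>"
      by (rule continuous_mapI_limitin) (simp add: tendsto_completion_iff[OF \<iota>])
  qed (use is_completionD(3)[OF \<iota>] tendsto_completion_iff[OF \<iota>, of "\<lambda>a. a"] in simp_all)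
  with assms(2) show ?thesis by (simp add: embedding_map_in_subtopology)
qed

section \<open>Approximation of the Ellis semigroup by isometries\<close>

lemma separable_dense_sequence:
  assumes "separable_space (euclidean :: 'a::topological_space topology)"
  obtains q :: "nat \<Rightarrow> 'a::topological_space" where "closure (range q) = UNIV"
proof -
  obtain C :: "'a set" where C: "countable C" "closure C = UNIV"
    using assms by (auto simp: separable_space_def)
  then have "C \<noteq> {}" by auto
  with C show thesis using that[of "from_nat_into C"] by simp
qed

lemma closure_range_completion:
  fixes \<iota> :: "'a::metric_space \<Rightarrow> 'b::complete_space"
  assumes \<iota>: "is_completion \<iota>" and q: "closure (range q) = UNIV"
  shows "closure (range (\<lambda>k. \<iota> (q k))) = UNIV"
proof -
  have "continuous_on UNIV \<iota>"
    unfolding continuous_on_iff by (auto simp: is_completionD[OF \<iota>])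
  then have "\<iota> ` closure (range q) \<subseteq> closure (\<iota> ` range q)"
    by (intro image_closure_subset closure_subset closed_closure)
      (auto intro: continuous_on_subset)
  then have "range \<iota> \<subseteq> closure (range (\<lambda>k. \<iota> (q k)))"
    by (simp add: q image_image)
  then have "closure (range \<iota>) \<subseteq> closure (range (\<lambda>k. \<iota> (q k)))"
    by (simp add: closure_minimal)
  then show ?thesis by (simp add: is_completionD(2)[OF \<iota>] top.extremum_unique)
qed

text \<open>Finitely many points and one tolerance give a basic neighbourhood of f for pointwise
  convergence, and it meets the extended isometries. A single index n governs both the number of
  points and the tolerance, so letting n grow refines both at once.\<close>

lemma Ellis_approx:
  assumes "f \<in> Ellis \<iota>"
  shows "\<exists>u\<in>Iso. \<forall>k\<le>n. dist (extension \<iota> u (p k)) (f (p k)) < inverse (real (Suc n))"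
proof -
  let ?U = "\<Inter>k\<in>{..n}. {h. dist (h (p k)) (f (p k)) < inverse (real (Suc n))}"
  have "open ?U"
    by (intro open_INT open_Collect_less continuous_intros continuous_on_product_coordinates
        ballI finite_atMost)
  moreover have "f \<in> ?U" by simp
  moreover have "f \<in> closure (extension \<iota> ` Iso \<inter> continuous_selfmaps)"
    using assms by (simp add: Ellis_iff)
  ultimately have "?U \<inter> (extension \<iota> ` Iso \<inter> continuous_selfmaps) \<noteq> {}"
    using open_Int_closure_eq_empty by blast
  then show ?thesis by auto
qed

text \<open>The choice of \<open>u\<close> is made once for all f and n, and the limit allows f to
  vary along the net. A constant f then gives a sequence for \<open>limit_maps\<close>; a varying f
  gives the diagonal net in \<open>Ellis_convergent_subnet\<close>. Separability supplies the
  countably many test points that make natural numbers suffice as indices.\<close>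

lemma Ellis_approximants:
  fixes \<iota> :: "'a::metric_space \<Rightarrow> 'b::complete_space"
  assumes "separable_space (euclidean :: 'a topology)" and \<iota>: "is_completion \<iota>"
  obtains u :: "('b \<Rightarrow> 'b) \<Rightarrow> nat \<Rightarrow> 'a \<Rightarrow> 'a" where
    "\<And>f n. f \<in> Ellis \<iota> \<Longrightarrow> u f n \<in> Iso"
    "\<And>(f :: 'i \<Rightarrow> 'b \<Rightarrow> 'b) n F y. eventually (\<lambda>i. f i \<in> Ellis \<iota>) F \<Longrightarrow>
      filterlim n sequentially F \<Longrightarrow>
      ((\<lambda>i. dist (extension \<iota> (u (f i) (n i)) y) (f i y)) \<longlongrightarrow> 0) F"
proof -
  obtain q :: "nat \<Rightarrow> 'a" where q: "closure (range q) = UNIV"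
    using separable_dense_sequence[OF assms(1)] by blast
  define p where "p k = \<iota> (q k)" for k
  have p: "closure (range p) = UNIV"
    using closure_range_completion[OF \<iota> q] by (simp add: p_def)
  let ?A = "\<lambda>f n v. v \<in> Iso \<and>
    (\<forall>k\<le>n. dist (extension \<iota> v (p k)) (f (p k)) < inverse (real (Suc n)))"
  define u where "u f n = (SOME v. ?A f n v)" for f n
  have A: "?A f n (u f n)" if "f \<in> Ellis \<iota>" for f n
  proof -
    have "\<exists>v. ?A f n v" using Ellis_approx[OF that, of n p] by blast
    then show ?thesis unfolding u_def by (rule someI_ex)
  qed
  then have u: "\<And>f n. f \<in> Ellis \<iota> \<Longrightarrow> u f n \<in> Iso"
    "\<And>f n k. f \<in> Ellis \<iota> \<Longrightarrow> k \<le> n \<Longrightarrow>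
      dist (extension \<iota> (u f n) (p k)) (f (p k)) < inverse (real (Suc n))"
    by auto
  show thesis
  proof (rule that[OF u(1)])
    fix f :: "'i \<Rightarrow> 'b \<Rightarrow> 'b" and n F y
    assume f: "eventually (\<lambda>i. f i \<in> Ellis \<iota>) F" and n: "filterlim n sequentially F"
    show "((\<lambda>i. dist (extension \<iota> (u (f i) (n i)) y) (f i y)) \<longlongrightarrow> 0) F"
    proof (rule tendsto_isometric_dense[where
          f = "\<lambda>i. extension \<iota> (u (f i) (n i))" and h = f, OF _ _ p])
      show "eventually (\<lambda>i. extension \<iota> (u (f i) (n i)) \<in> isometric_maps) F"
        using f by (rule eventually_mono) (simp add: extension_isometric \<iota> u)
      show "eventually (\<lambda>i. f i \<in> isometric_maps) F"
        using f by (rule eventually_mono) (use Ellis_isometric[OF \<iota>] in auto)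
      fix x assume "x \<in> range p"
      then obtain k where x: "x = p k" by blast
      \<comment> \<open>From there on \<open>p k\<close> is among the controlled points, with an
        error bound depending on \<open>n i\<close> but not on the map \<open>f i\<close>.\<close>
      have "eventually (\<lambda>i. k \<le> n i) F"
        using n by (simp add: filterlim_at_top)
      with f have "eventually (\<lambda>i. norm (dist (extension \<iota> (u (f i) (n i)) x) (f i x))
          \<le> inverse (real (Suc (n i)))) F"
        by eventually_elim
          (unfold x real_norm_def abs_of_nonneg[OF zero_le_dist], rule less_imp_le, rule u(2))
      then show "((\<lambda>i. dist (extension \<iota> (u (f i) (n i)) x) (f i x)) \<longlongrightarrow> 0) F"
        by (rule Lim_null_comparison) (rule filterlim_compose[OF LIMSEQ_inverse_real_of_nat n])
    qed
  qed
qed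

lemma limit_maps_subset_Ellis:
  assumes \<iota>: "is_completion \<iota>"
  shows "limit_maps \<iota> \<subseteq> Ellis \<iota>"
proof
  fix h assume "h \<in> limit_maps \<iota>"
  then obtain g where g: "range g \<subseteq> Iso"
    and lim: "limitin (pointwise continuous_selfmaps) (\<lambda>n. extension \<iota> (g n)) h sequentially"
    by (auto simp: limit_maps_def)
  show "h \<in> Ellis \<iota>"
    by (rule Ellis_if_limit[OF \<iota> sequentially_bot, of "\<lambda>n. extension \<iota> (g n)"])
      (use g lim in \<open>auto simp: limitin_pointwise intro!: extension_in_Ellis[OF \<iota>] always_eventually\<close>)
qed

text \<open>The approximating sequence decides the case. If it tends to infinity, it witnesses
  membership in \<open>limit_maps\<close>; otherwise a subnet converges to some w in
  \<open>Iso\<close>, and uniqueness of limits makes f the extension of w.\<close>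

lemma Ellis_subset_limit_maps:
  fixes \<iota> :: "'a::metric_space \<Rightarrow> 'b::complete_space"
  assumes sep: "separable_space (euclidean :: 'a topology)" and \<iota>: "is_completion \<iota>"
  shows "Ellis \<iota> \<subseteq> extension \<iota> ` Iso \<union> limit_maps \<iota>"
proof
  fix f assume f: "f \<in> Ellis \<iota>"
  obtain u :: "('b \<Rightarrow> 'b) \<Rightarrow> nat \<Rightarrow> 'a \<Rightarrow> 'a" where u: "\<And>f n. f \<in> Ellis \<iota> \<Longrightarrow> u f n \<in> Iso"
    and lim: "\<And>(f :: nat \<Rightarrow> 'b \<Rightarrow> 'b) n F y. eventually (\<lambda>i. f i \<in> Ellis \<iota>) F \<Longrightarrow>
      filterlim n sequentially F \<Longrightarrow>
      ((\<lambda>i. dist (extension \<iota> (u (f i) (n i)) y) (f i y)) \<longlongrightarrow> 0) F"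
    by (rule Ellis_approximants[OF sep \<iota>]) blast
  let ?g = "u f"
  have lim_f: "((\<lambda>n. extension \<iota> (?g n) y) \<longlongrightarrow> f y) sequentially" for y
    using lim[of "\<lambda>_. f" sequentially "\<lambda>n. n" y] f
    by (simp add: tendsto_dist_iff[symmetric] filterlim_ident)
  have cont: "f \<in> continuous_selfmaps" using f by (simp add: Ellis_iff continuous_selfmaps_def)
  show "f \<in> extension \<iota> ` Iso \<union> limit_maps \<iota>"
  proof (cases "net_to_infinity (pointwise Iso) ?g sequentially")
    case True
    moreover have "limitin (pointwise continuous_selfmaps) (\<lambda>n. extension \<iota> (?g n)) f sequentially"
      using lim_f cont u[OF f] continuous_on_extension[OF \<iota>]
      by (simp add: limitin_pointwise continuous_selfmaps_def)
    moreover have "range ?g \<subseteq> Iso" using u[OF f] by blast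
    ultimately show ?thesis using cont unfolding limit_maps_def by blast
  next
    case False
    then obtain F w where F: "F \<le> sequentially" "F \<noteq> bot" "limitin (pointwise Iso) ?g w F"
      by (auto simp: net_to_infinity_def)
    then have w: "w \<in> Iso" "eventually (\<lambda>n. ?g n \<in> Iso) F" "\<And>x. ((\<lambda>n. ?g n x) \<longlongrightarrow> w x) F"
      by (auto simp: limitin_pointwise)
    have "extension \<iota> w y = f y" for y
      by (rule tendsto_unique[OF F(2) tendsto_extension[OF \<iota> w] tendsto_mono[OF F(1) lim_f]])
    then have "f = extension \<iota> w" by auto
    with w show ?thesis by blast
  qed
qed

text \<open>Diagonal net: approximate \<open>f\<^sub>i\<close> within \<open>1/n\<close> by isometries \<open>v\<^sub>i\<^sub>n\<close> of \<open>X\<close>. If these have a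
  convergent subnet, its limit is the required one. Otherwise they tend to infinity, and
  Cauchy-indivisibility spreads convergence from one point of \<open>X\<close> to all of them.\<close>

lemma Ellis_convergent_subnet:
  fixes \<iota> :: "'a::metric_space \<Rightarrow> 'b::complete_space" and f :: "'i \<Rightarrow> 'b \<Rightarrow> 'b"
  assumes sep: "separable_space (euclidean :: 'a topology)" and \<iota>: "is_completion \<iota>"
    and CI: "Cauchy_indivisible (composition_monoid Iso) (pointwise Iso)
      (evaluation (UNIV :: 'a set))"
    and F: "F \<noteq> bot" and f: "eventually (\<lambda>i. f i \<in> Ellis \<iota>) F"
    and z: "((\<lambda>i. f i (\<iota> x)) \<longlongrightarrow> z) F"
  shows "\<exists>F' l. F' \<le> F \<and> F' \<noteq> bot \<and> limitin (pointwise (Ellis \<iota>)) f l F'"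
proof -
  obtain u :: "('b \<Rightarrow> 'b) \<Rightarrow> nat \<Rightarrow> 'a \<Rightarrow> 'a" where u: "\<And>f n. f \<in> Ellis \<iota> \<Longrightarrow> u f n \<in> Iso"
    and lim: "\<And>(f :: 'i \<times> nat \<Rightarrow> 'b \<Rightarrow> 'b) n F y. eventually (\<lambda>i. f i \<in> Ellis \<iota>) F \<Longrightarrow>
      filterlim n sequentially F \<Longrightarrow>
      ((\<lambda>i. dist (extension \<iota> (u (f i) (n i)) y) (f i y)) \<longlongrightarrow> 0) F"
    by (rule Ellis_approximants[OF sep \<iota>]) blast
  \<comment> \<open>The precision n runs to infinity independently of i, so the approximation error
    vanishes along P at every point.\<close>
  define P where "P = F \<times>\<^sub>F sequentially"
  define v where "v j = u (f (fst j)) (snd j)" for j :: "'i \<times> nat"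
  have P: "P \<noteq> bot" using F by (simp add: P_def prod_filter_eq_bot)
  have fst: "filtermap fst P \<le> F" and snd: "filterlim snd sequentially P"
    unfolding P_def filterlim_def
    by (rule filtermap_fst_prod_filter filtermap_snd_prod_filter)+
  have fP: "eventually (\<lambda>j. f (fst j) \<in> Ellis \<iota>) P"
    using filter_leD[OF fst f] by (simp add: eventually_filtermap)
  then have v: "eventually (\<lambda>j. v j \<in> Iso) P"
    by (rule eventually_mono) (simp add: v_def u)
  have v_ext: "eventually (\<lambda>j. extension \<iota> (v j) (\<iota> y) = \<iota> (v j y)) P" for y
    using v by (rule eventually_mono) (simp add: extension_apply \<iota>)
  have near: "((\<lambda>j. dist (extension \<iota> (v j) y) (f (fst j) y)) \<longlongrightarrow> 0) P" for y
    unfolding v_def by (rule lim[OF fP snd])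
  \<comment> \<open>Limits can be exchanged between the given maps and their approximants along
    every finer filter, so it suffices to find a convergent subnet of the approximants.\<close>
  have conv: "((\<lambda>j. f (fst j) y) \<longlongrightarrow> l) P' \<longleftrightarrow> ((\<lambda>j. extension \<iota> (v j) y) \<longlongrightarrow> l) P'"
    if "P' \<le> P" for P' l y
  proof -
    note n = tendsto_mono[OF that near[of y]]
    have n': "((\<lambda>j. dist (f (fst j) y) (extension \<iota> (v j) y)) \<longlongrightarrow> 0) P'"
      using n by (simp only: dist_commute)
    show ?thesis
      by (rule iffI; erule tendsto_transform_dist) (fact n n')+
  qed
  have "\<exists>P' l. P' \<le> P \<and> P' \<noteq> bot \<and> (\<forall>y. ((\<lambda>j. extension \<iota> (v j) y) \<longlongrightarrow> l y) P')"
  proof (cases "net_to_infinity (pointwise Iso) v P")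
    case False
    then obtain P' w where P': "P' \<le> P" "P' \<noteq> bot" "limitin (pointwise Iso) v w P'"
      by (auto simp: net_to_infinity_def)
    then have "w \<in> Iso" "eventually (\<lambda>j. v j \<in> Iso) P'" "\<And>x. ((\<lambda>j. v j x) \<longlongrightarrow> w x) P'"
      by (auto simp: limitin_pointwise)
    then have "((\<lambda>j. extension \<iota> (v j) y) \<longlongrightarrow> extension \<iota> w y) P'" for y
      by (rule tendsto_extension[OF \<iota>])
    with P' show ?thesis by blast
  next
    case True
    have "((\<lambda>j. f (fst j) (\<iota> x)) \<longlongrightarrow> z) P"
      using tendsto_mono[OF fst z] by (simp add: filterlim_filtermap)
    then have "((\<lambda>j. extension \<iota> (v j) (\<iota> x)) \<longlongrightarrow> z) P" by (simp add: conv)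
    then have "((\<lambda>j. \<iota> (v j x)) \<longlongrightarrow> z) P"
      using v_ext by (rule Lim_transform_eventually)
    then have "cauchy_filter (filtermap (\<lambda>j. \<iota> (v j x)) P)"
      by (simp add: filterlim_def nhds_imp_cauchy_filter)
    \<comment> \<open>The limit z may lie outside X, so in X the net is only known to be Cauchy,
      which is what Cauchy-indivisibility takes as input.\<close>
    then have "cauchy_filter (filtermap (\<lambda>j. evaluation UNIV (v j) x) P)"
      by (simp add: cauchy_filter_metric_filtermap is_completionD[OF \<iota>] evaluation_def)
    then have "cauchy_filter (filtermap (\<lambda>j. evaluation UNIV (v j) y) P)" for y
      using Cauchy_indivisible_netD[OF CI P _ True] v by simp
    then have "cauchy_filter (filtermap (\<lambda>j. \<iota> (v j y)) P)" for y
      by (simp add: cauchy_filter_metric_filtermap is_completionD[OF \<iota>] evaluation_def)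
    then have c: "\<exists>l. ((\<lambda>j. \<iota> (v j y)) \<longlongrightarrow> l) P" for y
      by (rule Cauchy_convergent_filter[OF _ P])
    \<comment> \<open>Cauchy-indivisibility reaches only points of X. For other y, a point s of X
      close to y is inserted: two quarters of e pay for moving between y and s, two for the
      distances to the limit at s.\<close>
    have "cauchy_filter (filtermap (\<lambda>j. extension \<iota> (v j) y) P)" for y
      unfolding cauchy_filter_metric_filtermap
    proof (intro allI impI)
      fix e :: real assume e: "e > 0"
      then obtain s where s: "dist (\<iota> s) y < e / 4"
        using is_completionD(2)[OF \<iota>] closure_approachable[of y "range \<iota>"]
        by (metis UNIV_I divide_pos_pos zero_less_numeral imageE)
      obtain l where l: "((\<lambda>j. \<iota> (v j s)) \<longlongrightarrow> l) P" using c by blast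
      have "eventually (\<lambda>j. dist (\<iota> (v j s)) l < e / 4) P"
        using tendstoD[OF l, of "e / 4"] e by simp
      with v have ev: "eventually (\<lambda>j. v j \<in> Iso \<and> dist (\<iota> (v j s)) l < e / 4) P"
        by eventually_elim simp
      have "dist (extension \<iota> (v i) y) (extension \<iota> (v j) y) < e"
        if "v i \<in> Iso \<and> dist (\<iota> (v i s)) l < e / 4" "v j \<in> Iso \<and> dist (\<iota> (v j s)) l < e / 4" for i j
      proof -
        have "dist (extension \<iota> (v k) y) (\<iota> (v k s)) < e / 4" if "v k \<in> Iso" for k
          using s isometric_mapsD[OF extension_isometric[OF \<iota> that], of y "\<iota> s"]
          by (simp add: extension_apply[OF \<iota> that] dist_commute)
        from this[of i] this[of j] that show ?thesis by metric
      qed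
      with ev show "\<exists>Q. eventually Q P \<and> (\<forall>i j. Q i \<and> Q j \<longrightarrow>
          dist (extension \<iota> (v i) y) (extension \<iota> (v j) y) < e)"
        by blast
    qed
    then have "\<forall>y. \<exists>l. ((\<lambda>j. extension \<iota> (v j) y) \<longlongrightarrow> l) P"
      using Cauchy_convergent_filter[OF _ P] by blast
    \<comment> \<open>In this case P itself serves as \<open>P'\<close>: the net converges at every
      point, without passing to a subnet.\<close>
    then show ?thesis using P by (metis order_refl)
  qed
  then obtain P' l where P': "P' \<le> P" "P' \<noteq> bot"
    and l: "\<And>y. ((\<lambda>j. f (fst j) y) \<longlongrightarrow> l y) P'"
    by (auto simp: conv)
  have "l \<in> Ellis \<iota>"
    by (rule Ellis_if_limit[OF \<iota> P'(2) filter_leD[OF P'(1) fP] l])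
  moreover have F': "filtermap fst P' \<le> F"
    using P'(1) fst by (meson filtermap_mono order_trans)
  \<comment> \<open>Projecting the pairs (i, n) to i turns the subnet of the diagonal net into a
    subnet of the original one.\<close>
  moreover have "((\<lambda>i. f i y) \<longlongrightarrow> l y) (filtermap fst P')" for y
    using l by (simp add: filterlim_filtermap)
  ultimately have "limitin (pointwise (Ellis \<iota>)) f l (filtermap fst P')"
    using filter_leD[OF F' f] by (simp add: limitin_pointwise)
  with F' P'(2) show ?thesis by (metis filtermap_bot_iff)
qed

theorem corollary5p18:
  fixes \<iota> :: "'a::metric_space \<Rightarrow> 'b::complete_space"
  defines "IsoG \<equiv> composition_monoid (Iso :: ('a \<Rightarrow> 'a) set)"
    and "IsoT \<equiv> pointwise (Iso :: ('a \<Rightarrow> 'a) set)"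
    and "EG \<equiv> composition_monoid (Ellis \<iota>)"
    and "ET \<equiv> pointwise (Ellis \<iota>)"
    and "Y \<equiv> range \<iota> \<union> limit_points \<iota>"
  assumes "separable_space (euclidean :: 'a topology)"
    and "is_completion \<iota>"
    and "Cauchy_indivisible IsoG IsoT (evaluation UNIV)"
    and "group EG"
  shows "continuous_action IsoG IsoT euclidean (evaluation UNIV)
    \<and> proper_action EG ET (top_of_set Y) (evaluation Y)
    \<and> extension \<iota> \<in> hom IsoG EG
    \<and> embedding_map IsoT ET (extension \<iota>)
    \<and> ET closure_of (extension \<iota> ` Iso) = Ellis \<iota>
    \<and> embedding_map euclidean (top_of_set Y) \<iota>
    \<and> top_of_set Y closure_of (range \<iota>) = Y
    \<and> (\<forall>g \<in> Iso. \<forall>x. evaluation Y (extension \<iota> g) (\<iota> x) = \<iota> (evaluation UNIV g x))"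
proof -
  note sep = assms(6) and \<iota> = assms(7) and CI = assms(8)[unfolded IsoG_def IsoT_def]
    and G = assms(9)[unfolded EG_def]
  let ?E = "Ellis \<iota>"
  note iso = Ellis_isometric[OF \<iota>]
  have cl: "f \<circ> g \<in> ?E" if "f \<in> ?E" "g \<in> ?E" for f g
    using monoid.m_closed[OF group.is_monoid[OF G]] that by simp
  have id: "id \<in> ?E"
    using monoid.one_closed[OF group.is_monoid[OF G]] by simp
  \<comment> \<open>In orbit form, invariance of Y is closure of E under composition, and each point
    of Y can be traced back to a point of X.\<close>
  have Y: "Y = {f (\<iota> x) |f x. f \<in> ?E}"
  proof
    have "\<iota> x = id (\<iota> x)" for x by simp
    then show "Y \<subseteq> {f (\<iota> x) |f x. f \<in> ?E}"
      using id limit_maps_subset_Ellis[OF \<iota>] unfolding Y_def limit_points_def by blast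
    have "f (\<iota> x) \<in> Y" if f: "f \<in> ?E" for f x
    proof -
      consider g where "g \<in> Iso" "f = extension \<iota> g" | "f \<in> limit_maps \<iota>"
        using Ellis_subset_limit_maps[OF sep \<iota>] f by blast
      then show ?thesis
        by cases (auto simp: Y_def limit_points_def extension_apply[OF \<iota>])
    qed
    then show "{f (\<iota> x) |f x. f \<in> ?E} \<subseteq> Y" by blast
  qed
  have invariant: "f y \<in> Y" if f: "f \<in> ?E" and y: "y \<in> Y" for f y
  proof -
    obtain h x where h: "y = h (\<iota> x)" "h \<in> ?E" using y by (auto simp: Y)
    have "(f \<circ> h) (\<iota> x) \<in> Y" using cl[OF f h(2)] unfolding Y by blast
    then show ?thesis by (simp add: h)
  qed
  have "continuous_action EG ET (top_of_set Y) (evaluation Y)"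
    unfolding EG_def ET_def by (rule continuous_action_isometries[OF G iso]) (rule invariant)
  moreover have "\<not> net_to_infinity ET fst F"
    if x: "x \<in> topspace (top_of_set Y)" and F: "F \<noteq> bot"
      and ev: "eventually (\<lambda>(g, z). g \<in> carrier EG \<and> z \<in> topspace (top_of_set Y)) F"
      and l1: "limitin (top_of_set Y) snd x F"
      and l2: "limitin (top_of_set Y) (\<lambda>(g, z). evaluation Y g z) y F"
    for x y and F :: "(('b \<Rightarrow> 'b) \<times> 'b) filter"
  proof -
    have ev': "eventually (\<lambda>p. fst p \<in> ?E \<and> snd p \<in> Y) F"
      using ev by (rule eventually_mono) (auto simp: EG_def)
    have fE: "eventually (\<lambda>p. fst p \<in> ?E) F"
      using ev' by (rule eventually_mono) simp
    have snd: "(snd \<longlongrightarrow> x) F" and "((\<lambda>(g, z). evaluation Y g z) \<longlongrightarrow> y) F"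
      using l1 l2 by (auto simp: limitin_subtopology)
    moreover have "eventually (\<lambda>p. (case p of (g, z) \<Rightarrow> evaluation Y g z) = fst p (snd p)) F"
      using ev' by (rule eventually_mono) (auto simp: evaluation_def)
    ultimately have "((\<lambda>p. fst p (snd p)) \<longlongrightarrow> y) F"
      by (blast intro: Lim_transform_eventually)
    \<comment> \<open>Since the maps preserve distances, the moving points can be replaced by their
      limit x without changing the limit y.\<close>
    moreover have "((\<lambda>p. dist (fst p (snd p)) (fst p x)) \<longlongrightarrow> 0) F"
    proof (rule Lim_transform_eventually)
      show "((\<lambda>p. dist (snd p) x) \<longlongrightarrow> 0) F" using snd by (rule iffD1[OF tendsto_dist_iff])
      show "eventually (\<lambda>p. dist (snd p) x = dist (fst p (snd p)) (fst p x)) F"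
        using fE by (rule eventually_mono) (use iso in \<open>auto simp: isometric_mapsD\<close>)
    qed
    ultimately have lim: "((\<lambda>p. fst p x) \<longlongrightarrow> y) F"
      by (rule tendsto_transform_dist)
    \<comment> \<open>\<open>Ellis_convergent_subnet\<close> needs convergence at a point of X. The
      net of the \<open>fst p \<circ> h\<close> stays in E and converges at s in place of x.\<close>
    obtain h s where h: "x = h (\<iota> s)" "h \<in> ?E" using x unfolding topspace_euclidean_subtopology Y by blast
    let ?h = "inv\<^bsub>composition_monoid ?E\<^esub> h"
    note hi = composition_group_inv[OF G h(2)]
    have "eventually (\<lambda>p. fst p \<circ> h \<in> ?E) F"
      using fE by (rule eventually_mono) (rule cl[OF _ h(2)])
    moreover have "((\<lambda>p. (fst p \<circ> h) (\<iota> s)) \<longlongrightarrow> y) F" using lim by (simp add: h)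
    ultimately obtain F' l where F': "F' \<le> F" "F' \<noteq> bot"
      and "limitin (pointwise ?E) (\<lambda>p. fst p \<circ> h) l F'"
      using Ellis_convergent_subnet[OF sep \<iota> CI F, of "\<lambda>p. fst p \<circ> h"] by blast
    then have l: "l \<in> ?E" "\<And>t. ((\<lambda>p. fst p (h t)) \<longlongrightarrow> l t) F'"
      by (auto simp: limitin_pointwise)
    \<comment> \<open>Every t equals h (\<open>?h\<close> t), so convergence on the image of h is
      convergence everywhere.\<close>
    have "((\<lambda>p. fst p t) \<longlongrightarrow> (l \<circ> ?h) t) F'" for t
      using l(2)[of "?h t"] by (simp add: hi)
    then have "limitin ET fst (l \<circ> ?h) F'"
      using filter_leD[OF F'(1) fE] cl[OF l(1) hi(1)] by (simp add: ET_def limitin_pointwise)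
    with F' show ?thesis by (auto simp: net_to_infinity_def)
  qed
  ultimately have proper: "proper_action EG ET (top_of_set Y) (evaluation Y)"
    unfolding proper_action_def by blast
  have action: "continuous_action IsoG IsoT euclidean (evaluation UNIV)"
    using continuous_action_isometries[OF group_Iso Iso_subset_isometric_maps, of UNIV]
    by (simp add: IsoG_def IsoT_def)
  have ext: "extension \<iota> ` Iso \<subseteq> ?E" using extension_in_Ellis[OF \<iota>] by auto
  have dense: "ET closure_of (extension \<iota> ` Iso) = ?E"
  proof
    show "ET closure_of (extension \<iota> ` Iso) \<subseteq> ?E"
      using closure_of_subset_topspace[of ET] by (simp add: ET_def)
    have "?E \<subseteq> closure (extension \<iota> ` Iso)"
      using closure_mono[of "extension \<iota> ` Iso \<inter> continuous_selfmaps" "extension \<iota> ` Iso"]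
      by (auto simp: Ellis_iff)
    then show "?E \<subseteq> ET closure_of (extension \<iota> ` Iso)"
      using ext by (simp add: ET_def pointwise_def closure_of_subtopology Int_absorb1)
  qed
  have \<iota>Y: "range \<iota> \<subseteq> Y" by (simp add: Y_def)
  have "top_of_set Y closure_of (range \<iota>) = Y"
    using \<iota>Y by (simp add: closure_of_subtopology Int_absorb1 is_completionD(2)[OF \<iota>])
  moreover have "evaluation Y (extension \<iota> g) (\<iota> x) = \<iota> (evaluation UNIV g x)" if "g \<in> Iso" for g x
    using that \<iota>Y by (auto simp: evaluation_def extension_apply[OF \<iota>])
  ultimately show ?thesis
    using action proper dense extension_hom[OF \<iota>] extension_embedding[OF \<iota>]
      completion_embedding[OF \<iota> \<iota>Y]
    by (simp add: IsoG_def IsoT_def EG_def ET_def)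
qed

end
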